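(* Let $G$ and $H$ be finite groups of coprime order, and suppose that $G$ is abelian. Let $K$ be any extension of $G$ by $H$ (that is, $K$ is a group with a normal subgroup isomorphic to $G$ whose quotient is isomorphic to $H$). Then $\mathrm{os}(G\times H)=\mathrm{os}(G)\,\mathrm{os}(H)$ strongly dominates $\mathrm{os}(K)$.
   Context: For a finite group $G$ of order $n$, the order sequence $\mathrm{os}(G)$ is the list of orders $o(g)$ of all elements $g\in G$ arranged in non-decreasing order. For non-decreasing sequences $x=(x_1,\dots,x_m)$ and $y=(y_1,\dots,y_n)$ of positive integers, $xy$ is the sequence obtained by taking all products $x_iy_j$ and writing them in non-decreasing order; $\mathrm{os}(G)\,\mathrm{os}(H)$ is the product in this sense. For finite groups $A$ and $B$ of the same order, $\mathrm{os}(A)$ strongly dominates $\mathrm{os}(B)$ if there is a bijection $f:A\to B$ such that $o(f(a))\mid o(a)$ for all $a\in A$. *)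

theory Defs
  imports "HOL-Algebra.Algebra" "HOL-Library.Multiset"
begin

definition order_sequence :: "('a, 'm) monoid_scheme \<Rightarrow> nat list" where
  "order_sequence G = sorted_list_of_multiset (image_mset (group.ord G) (mset_set (carrier G)))"

definition seq_product :: "nat list \<Rightarrow> nat list \<Rightarrow> nat list" where
  "seq_product xs ys = sort (map (\<lambda>(x, y). x * y) (List.product xs ys))"

(* Strong domination of os(B) by os(A) is phrased through the groups themselves, as a relation
   between finite groups of the same order; the equality of orders is implied by the bijection. *)
definition strongly_dominates :: "('a, 'm) monoid_scheme \<Rightarrow> ('b, 'n) monoid_scheme \<Rightarrow> bool" where
  "strongly_dominates A B \<longleftrightarrow>
     (\<exists>f. bij_betw f (carrier A) (carrier B) \<and>
          (\<forall>a \<in> carrier A. group.ord B (f a) dvd group.ord A a))"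

(* K is an extension of G by H: G is the normal subgroup and H the quotient. *)
definition is_extension ::
    "('k, 'l) monoid_scheme \<Rightarrow> ('a, 'm) monoid_scheme \<Rightarrow> ('b, 'n) monoid_scheme \<Rightarrow> bool" where
  "is_extension K G H \<longleftrightarrow>
     group K \<and> (\<exists>N. N \<lhd> K \<and> K\<lparr>carrier := N\<rparr> \<cong> G \<and> K Mod N \<cong> H)"

end

theory Submission
  imports Defs
begin

text \<open>
  Write \<open>N\<close> for the normal copy of \<open>G\<close> in \<open>K\<close> and \<open>\<pi>\<close> for the projection of \<open>K\<close> onto \<open>H\<close>. Two
  observations replace the Schur--Zassenhaus theorem and the structure theory of coprime actions.

  Every coset of \<open>N\<close> contains an element whose order divides that of the coset: if \<open>\<pi> y\<close> has order
  \<open>m\<close>, then \<open>y\<close> to the power \<open>m\<close> lies in \<open>N\<close>, and raising \<open>y\<close> to an exponent which is \<open>1\<close> modulo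
  \<open>m\<close> and \<open>0\<close> modulo the order of \<open>N\<close> does not change the coset but kills the \<open>m\<close>-th power
  (\<open>exists_lift_of_same_exponent\<close>). This picks a transversal \<open>s\<close>, which need not be a homomorphism.

  For \<open>y\<close> with \<open>y\<close> to the power \<open>m\<close> trivial, and \<open>a\<close> in \<open>N\<close>, the \<open>m\<close>-th power of \<open>a y\<close> is the
  norm of \<open>a\<close>, the product of the conjugates of \<open>a\<close> by the powers of \<open>y\<close>. As \<open>N\<close> is abelian, the
  norm is an endomorphism of \<open>N\<close>, so the order of the norm of \<open>a\<close> divides the order of \<open>a\<close>. Hence
  the order of \<open>a y\<close> divides the product of \<open>m\<close> and the order of \<open>a\<close>
  (\<open>pow_mult_of_normal_abelian\<close>).

  The map sending \<open>(g, x)\<close> to the product of the copy of \<open>g\<close> in \<open>N\<close> with \<open>s x\<close> is a bijection from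
  \<open>G \<times> H\<close> to \<open>K\<close>, because \<open>s\<close> is a transversal. The orders of \<open>G\<close> and \<open>H\<close> being coprime, the order
  of \<open>(g, x)\<close> is the product of the orders of \<open>g\<close> and \<open>x\<close>; this gives both the formula for the order
  sequence of \<open>G \<times> H\<close> and, with the two observations, the required divisibility.
\<close>

section \<open>Order sequences of direct products\<close>

lemma pow_DirProd:
  "(g, h) [^]\<^bsub>G \<times>\<times> H\<^esub> (n :: nat) = (g [^]\<^bsub>G\<^esub> n, h [^]\<^bsub>H\<^esub> n)"
  by (induction n) (simp_all add: nat_pow_def DirProd_def)

text \<open>
  A power of a pair is trivial exactly when both orders divide the exponent; for coprime orders this
  says that their product divides it.
\<close>

lemma ord_DirProd_coprime:
  assumes G: "group G" and H: "group H"
    and g: "g \<in> carrier G" and h: "h \<in> carrier H"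
    and coprime: "coprime (group.ord G g) (group.ord H h)"
  shows "group.ord (G \<times>\<times> H) (g, h) = group.ord G g * group.ord H h"
proof -
  interpret P: group "G \<times>\<times> H"
    using G H by (rule DirProd_group)
  have "(g, h) [^]\<^bsub>G \<times>\<times> H\<^esub> n = \<one>\<^bsub>G \<times>\<times> H\<^esub> \<longleftrightarrow> group.ord G g * group.ord H h dvd n" for n :: nat
    using group.pow_eq_id[OF G g, of n] group.pow_eq_id[OF H h, of n] coprime
    by (auto simp: pow_DirProd intro: divides_mult dvd_mult_left dvd_mult_right)
  then show ?thesis
    using g h by (subst P.ord_unique) auto
qed

lemma coprime_ord:
  assumes "group G" and "group H" and "coprime (order G) (order H)"
    and "g \<in> carrier G" and "h \<in> carrier H"
  shows "coprime (group.ord G g) (group.ord H h)"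
  by (rule coprime_divisors[OF group.ord_dvd_group_order group.ord_dvd_group_order]) (fact assms)+

lemma mset_product:
  "mset (List.product xs ys) = (\<Sum>x\<in>#mset xs. image_mset (Pair x) (mset ys))"
  by (induction xs) auto

text \<open>
  The multiset of products depends only on the multisets of factors, so the factors may be listed in
  any order. This is what allows order sequences to be computed along arbitrary enumerations of the
  two groups.
\<close>

lemma seq_product_sort:
  "seq_product (sort xs) (sort ys) = sort (map (\<lambda>(x, y). x * y) (List.product xs ys))"
  unfolding seq_product_def
  by (rule properties_for_sort) (simp_all add: mset_product)

lemma product_map_map:
  "List.product (map f xs) (map g ys) = map (map_prod f g) (List.product xs ys)"
  by (induction xs) auto

lemma order_sequence_enumeration:
  assumes "carrier G = set xs" and "distinct xs"
  shows "order_sequence G = sort (map (group.ord G) xs)"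
  using assms by (simp add: order_sequence_def mset_set_set flip: mset_map)

lemma order_sequence_DirProd:
  assumes G: "group G" and finG: "finite (carrier G)"
    and H: "group H" and finH: "finite (carrier H)"
    and coprime: "coprime (order G) (order H)"
  shows "order_sequence (G \<times>\<times> H) = seq_product (order_sequence G) (order_sequence H)"
proof -
  obtain xs where xs: "carrier G = set xs" "distinct xs"
    using finite_distinct_list[OF finG] by metis
  obtain ys where ys: "carrier H = set ys" "distinct ys"
    using finite_distinct_list[OF finH] by metis
  have ord: "group.ord (G \<times>\<times> H) (g, h) = group.ord G g * group.ord H h"
    if "g \<in> carrier G" "h \<in> carrier H" for g h
    by (rule ord_DirProd_coprime[OF G H that coprime_ord[OF G H coprime that]])
  have "order_sequence (G \<times>\<times> H) = sort (map (group.ord (G \<times>\<times> H)) (List.product xs ys))"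
    using xs ys by (intro order_sequence_enumeration) (auto simp: distinct_product)
  also have "map (group.ord (G \<times>\<times> H)) (List.product xs ys) =
      map (\<lambda>(x, y). x * y) (List.product (map (group.ord G) xs) (map (group.ord H) ys))"
    using xs ys by (auto simp: product_map_map ord)
  also have "sort \<dots> = seq_product (order_sequence G) (order_sequence H)"
    using xs ys by (simp add: seq_product_sort order_sequence_enumeration)
  finally show ?thesis .
qed

section \<open>Powers of elements in a coset of a normal abelian subgroup\<close>

text \<open>
  For \<open>a\<close> in a normal subgroup this is the partial norm, the product of the conjugates of \<open>a\<close> by the
  first \<open>j\<close> powers of \<open>y\<close>; the closed form avoids an indexed product in a group that is not
  commutative.
\<close>

definition partial_norm :: "('a, 'm) monoid_scheme \<Rightarrow> 'a \<Rightarrow> nat \<Rightarrow> 'a \<Rightarrow> 'a" where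
  "partial_norm G y j a = (a \<otimes>\<^bsub>G\<^esub> y) [^]\<^bsub>G\<^esub> j \<otimes>\<^bsub>G\<^esub> inv\<^bsub>G\<^esub> (y [^]\<^bsub>G\<^esub> j)"

lemma (in group) partial_norm_Suc:
  assumes "a \<in> carrier G" and "y \<in> carrier G"
  shows "partial_norm G y (Suc j) a =
    partial_norm G y j a \<otimes> (y [^] j \<otimes> a \<otimes> inv (y [^] j))"
proof -
  have cancel: "y \<otimes> inv (y [^] Suc j) = inv (y [^] j)"
    using assms by (simp add: inv_mult_group m_assoc[symmetric])
  have "partial_norm G y (Suc j) a = (a \<otimes> y) [^] j \<otimes> (a \<otimes> (y \<otimes> inv (y [^] Suc j)))"
    using assms by (simp add: partial_norm_def m_assoc)
  also have "\<dots> = (a \<otimes> y) [^] j \<otimes> ((inv (y [^] j) \<otimes> y [^] j) \<otimes> (a \<otimes> inv (y [^] j)))"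
    unfolding cancel using assms by simp
  also have "\<dots> = partial_norm G y j a \<otimes> (y [^] j \<otimes> a \<otimes> inv (y [^] j))"
    unfolding partial_norm_def using assms
    by (simp only: m_assoc m_closed inv_closed nat_pow_closed)
  finally show ?thesis .
qed

lemma (in normal) partial_norm_closed:
  assumes "a \<in> H" and "y \<in> carrier G"
  shows "partial_norm G y j a \<in> H"
proof (induction j)
  case 0
  then show ?case
    by (simp add: partial_norm_def)
next
  case (Suc j)
  then show ?case
    using assms by (simp add: partial_norm_Suc inv_op_closed2)
qed

text \<open>
  Conjugation by a fixed element is multiplicative; commutativity of the subgroup allows the
  conjugates of the two factors to be regrouped.
\<close>

lemma (in normal) partial_norm_mult:
  assumes comm: "\<And>u v. u \<in> H \<Longrightarrow> v \<in> H \<Longrightarrow> u \<otimes> v = v \<otimes> u"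
    and a: "a \<in> H" and b: "b \<in> H" and y: "y \<in> carrier G"
  shows "partial_norm G y j (a \<otimes> b) = partial_norm G y j a \<otimes> partial_norm G y j b"
proof (induction j)
  case 0
  then show ?case
    using a b y by (simp add: partial_norm_def)
next
  case (Suc j)
  let ?c = "\<lambda>x. y [^] j \<otimes> x \<otimes> inv (y [^] j)"
  have c: "?c a \<in> H" "?c b \<in> H"
    using a b y by (simp_all add: inv_op_closed2)
  note N = partial_norm_closed[OF a y, of j] partial_norm_closed[OF b y, of j]
  note G = N[THEN mem_carrier] c[THEN mem_carrier]
  have "?c a \<otimes> ?c b = y [^] j \<otimes> a \<otimes> (inv (y [^] j) \<otimes> y [^] j) \<otimes> b \<otimes> inv (y [^] j)"
    using a b y by (simp only: m_assoc mem_carrier nat_pow_closed inv_closed m_closed)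
  also have "\<dots> = ?c (a \<otimes> b)"
    using a b y by (simp add: m_assoc)
  finally have conj: "?c (a \<otimes> b) = ?c a \<otimes> ?c b" ..
  have "partial_norm G y (Suc j) (a \<otimes> b) =
      partial_norm G y j a \<otimes> (partial_norm G y j b \<otimes> ?c a) \<otimes> ?c b"
    unfolding partial_norm_Suc[OF m_closed[OF a[THEN mem_carrier] b[THEN mem_carrier]] y] Suc.IH conj
    using G by (simp only: m_assoc m_closed)
  also have "\<dots> = partial_norm G y j a \<otimes> (?c a \<otimes> partial_norm G y j b) \<otimes> ?c b"
    by (simp only: comm[OF N(2) c(1)])
  also have "\<dots> = partial_norm G y (Suc j) a \<otimes> partial_norm G y (Suc j) b"
    unfolding partial_norm_Suc[OF mem_carrier[OF a] y] partial_norm_Suc[OF mem_carrier[OF b] y]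
    using G by (simp only: m_assoc m_closed)
  finally show ?case .
qed

text \<open>
  When the \<open>m\<close>-th power of \<open>y\<close> is trivial, the \<open>m\<close>-th power of \<open>a \<otimes> y\<close> is the image of \<open>a\<close> under
  the norm endomorphism, and endomorphisms preserve every exponent that kills \<open>a\<close>.
\<close>

lemma (in normal) pow_mult_of_normal_abelian:
  assumes comm: "\<And>u v. u \<in> H \<Longrightarrow> v \<in> H \<Longrightarrow> u \<otimes> v = v \<otimes> u"
    and a: "a \<in> H" and y: "y \<in> carrier G"
    and ym: "y [^] m = \<one>" and ak: "a [^] k = \<one>"
  shows "(a \<otimes> y) [^] (m * k :: nat) = \<one>"
proof -
  have norm: "partial_norm G y m b = (b \<otimes> y) [^] m" if "b \<in> H" for b
    using that y by (simp add: partial_norm_def ym)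
  have pow: "a [^] i \<in> H" for i :: nat
    using a by (induction i) auto
  have "partial_norm G y m (a [^] i) = partial_norm G y m a [^] i" for i :: nat
  proof (induction i)
    case 0
    then show ?case
      using y by (simp add: norm ym)
  next
    case (Suc i)
    then show ?case
      using partial_norm_mult[OF comm pow a y] by simp
  qed
  from this[of k] have "((a \<otimes> y) [^] m) [^] k = \<one>"
    using a y by (simp add: norm ym ak)
  then show ?thesis
    using a y by (simp add: nat_pow_pow)
qed

section \<open>Coprime extensions\<close>

text \<open>
  The lift is a power of \<open>y\<close>. An exponent that is \<open>1\<close> modulo \<open>m\<close> leaves the image of \<open>y\<close> unchanged;
  one that is also \<open>0\<close> modulo the order of the kernel annihilates the \<open>m\<close>-th power, since the
  \<open>m\<close>-th power of \<open>y\<close> lies in the kernel.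
\<close>

lemma (in group_hom) exists_lift_of_same_exponent:
  assumes fin: "finite (kernel G H h)" and coprime: "coprime (card (kernel G H h)) m"
    and y: "y \<in> carrier G" and pow: "h y [^]\<^bsub>H\<^esub> m = \<one>\<^bsub>H\<^esub>"
  shows "\<exists>z \<in> carrier G. h z = h y \<and> z [^] m = \<one>"
proof -
  define N where "N = kernel G H h"
  have sub: "subgroup N G"
    unfolding N_def by (rule subgroup_kernel)
  then interpret N: group "G\<lparr>carrier := N\<rparr>"
    by (rule subgroup.subgroup_is_group) (rule G.group_axioms)
  have ne: "card N \<noteq> 0"
    using fin sub subgroup.one_closed[OF sub] by (auto simp: N_def)
  obtain u v where uv: "card N * u = m * v + 1"
    using bezout_nat[OF ne, of m] coprime by (auto simp: N_def coprime_iff_gcd_eq_1)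
  define z where "z = y [^] (card N * u)"
  have ymN: "y [^] m \<in> N"
    using y pow by (simp add: N_def kernel_def hom_nat_pow)
  have "(y [^] m) [^] card N = \<one>"
    using N.pow_order_eq_1[of "y [^] m"] ymN
    by (simp add: order_def nat_pow_def)
  then have "z [^] m = \<one>"
    using y unfolding z_def
    by (metis G.nat_pow_one G.nat_pow_pow mult.assoc mult.commute)
  moreover have "h z = (h y [^]\<^bsub>H\<^esub> m) [^]\<^bsub>H\<^esub> v \<otimes>\<^bsub>H\<^esub> h y"
    using y by (simp add: z_def uv hom_nat_pow H.nat_pow_pow del: One_nat_def)
      (simp add: H.nat_pow_mult)
  then have "h z = h y"
    using y pow by simp
  ultimately show ?thesis
    using y by (auto simp: z_def)
qed

text \<open>
  Composing the coset map with the isomorphism onto \<open>H\<close> turns the extension into a surjection with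
  kernel isomorphic to \<open>G\<close>, so that cosets can be handled as fibres over the elements of \<open>H\<close>.
\<close>

lemma is_extensionE:
  assumes "is_extension K G H" and "group H"
  obtains \<pi> \<psi> where "group_hom K H \<pi>" and "\<pi> ` carrier K = carrier H"
    and "\<psi> \<in> iso G (K\<lparr>carrier := kernel K H \<pi>\<rparr>)"
proof -
  from assms(1) obtain N where K: "group K" and N: "N \<lhd> K"
    and "K\<lparr>carrier := N\<rparr> \<cong> G" and "K Mod N \<cong> H"
    unfolding is_extension_def by blast
  interpret K: group K by (rule K)
  interpret N: normal N K by (rule N)
  have "group (K\<lparr>carrier := N\<rparr>)"
    by (rule N.subgroup_is_group) (rule K)
  then obtain \<psi> where \<psi>: "\<psi> \<in> iso G (K\<lparr>carrier := N\<rparr>)"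
    using \<open>K\<lparr>carrier := N\<rparr> \<cong> G\<close> group.iso_sym unfolding is_iso_def by blast
  obtain \<theta> where \<theta>: "\<theta> \<in> iso (K Mod N) H"
    using \<open>K Mod N \<cong> H\<close> unfolding is_iso_def by blast
  define \<pi> where "\<pi> = (\<lambda>k. \<theta> (N #>\<^bsub>K\<^esub> k))"
  have "\<pi> \<in> hom K H"
    using hom_compose[OF N.r_coset_hom_Mod, of \<theta> H] \<theta> by (simp add: \<pi>_def comp_def iso_def)
  then have hom: "group_hom K H \<pi>"
    using K assms(2) by (simp add: group_hom_def group_hom_axioms_def)
  have carrier: "carrier (K Mod N) = (\<lambda>k. N #>\<^bsub>K\<^esub> k) ` carrier K"
    by (auto simp: FactGroup_def RCOSETS_def)
  then have surj: "\<pi> ` carrier K = carrier H"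
    using \<theta> by (simp add: \<pi>_def iso_iff image_image)
  have one: "\<theta> N = \<one>\<^bsub>H\<^esub>"
    using hom_one[of \<theta> "K Mod N" H] \<theta> N.factorgroup_is_group assms(2)
    by (simp add: iso_def)
  have inj: "inj_on \<theta> (carrier (K Mod N))"
    using \<theta> by (simp add: iso_iff)
  have N_in: "N \<in> carrier (K Mod N)"
    using N.factorgroup_is_group group.is_monoid monoid.one_closed by fastforce
  have "\<pi> k = \<one>\<^bsub>H\<^esub> \<longleftrightarrow> k \<in> N" if k: "k \<in> carrier K" for k
  proof -
    have "\<pi> k = \<one>\<^bsub>H\<^esub> \<longleftrightarrow> N #>\<^bsub>K\<^esub> k = N"
      using inj_on_eq_iff[OF inj _ N_in, of "N #>\<^bsub>K\<^esub> k"] k by (auto simp: \<pi>_def one carrier)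
    also have "\<dots> \<longleftrightarrow> k \<in> N"
      using k K.coset_join1[OF _ k N.subgroup_axioms] K.coset_join2[OF k N.subgroup_axioms]
        N.subset by blast
    finally show ?thesis .
  qed
  then have "kernel K H \<pi> = N"
    using N.subset by (auto simp: kernel_def)
  with hom surj \<psi> show ?thesis
    using that by simp
qed

text \<open>
  The bijection is translation of the copy of \<open>G\<close> along the transversal of good lifts: projecting to
  \<open>H\<close> recovers \<open>x\<close>, and cancelling \<open>s x\<close> then recovers \<open>g\<close>.
\<close>

lemma extension_strongly_dominated:
  assumes "comm_group G" and finG: "finite (carrier G)"
    and H: "group H" and finH: "finite (carrier H)"
    and coprime: "coprime (order G) (order H)"
    and ext: "is_extension K G H"
  shows "strongly_dominates (G \<times>\<times> H) K"
proof -
  interpret G: comm_group G by (rule assms(1))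
  obtain \<pi> \<psi> where hom: "group_hom K H \<pi>" and surj: "\<pi> ` carrier K = carrier H"
    and \<psi>: "\<psi> \<in> iso G (K\<lparr>carrier := kernel K H \<pi>\<rparr>)"
    using is_extensionE[OF ext H] .
  interpret \<pi>: group_hom K H \<pi> by (rule hom)
  define N where "N = kernel K H \<pi>"
  interpret N: normal N K
    unfolding N_def by (rule \<pi>.normal_kernel)
  have \<psi>_bij: "bij_betw \<psi> (carrier G) N"
    and \<psi>_mult: "\<And>u v. u \<in> carrier G \<Longrightarrow> v \<in> carrier G \<Longrightarrow> \<psi> (u \<otimes>\<^bsub>G\<^esub> v) = \<psi> u \<otimes>\<^bsub>K\<^esub> \<psi> v"
    using \<psi> by (auto simp: iso_def hom_def N_def)
  have \<psi>_inj: "inj_on \<psi> (carrier G)" and \<psi>_image: "N = \<psi> ` carrier G"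
    using \<psi>_bij by (simp_all add: bij_betw_def)
  have \<psi>_N: "\<psi> g \<in> N" if "g \<in> carrier G" for g
    unfolding \<psi>_image using that by (rule imageI)
  then have \<psi>_K: "\<psi> g \<in> carrier K" if "g \<in> carrier G" for g
    using that N.subset by blast
  have finN: "finite N" and cardN: "card N = order G"
    using bij_betw_finite[OF \<psi>_bij] bij_betw_same_card[OF \<psi>_bij] finG
    by (simp_all add: order_def)
  have comm: "u \<otimes>\<^bsub>K\<^esub> v = v \<otimes>\<^bsub>K\<^esub> u" if "u \<in> N" "v \<in> N" for u v
  proof -
    obtain u' where u': "u' \<in> carrier G" "u = \<psi> u'"
      using \<open>u \<in> N\<close> unfolding \<psi>_image by (rule imageE)
    obtain v' where v': "v' \<in> carrier G" "v = \<psi> v'"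
      using \<open>v \<in> N\<close> unfolding \<psi>_image by (rule imageE)
    show ?thesis
      using \<psi>_mult[of u' v'] \<psi>_mult[of v' u'] G.m_comm[of u' v'] u' v' by simp
  qed
  have \<psi>_pow: "\<psi> (g [^]\<^bsub>G\<^esub> i) = \<psi> g [^]\<^bsub>K\<^esub> i" if g: "g \<in> carrier G" for g and i :: nat
  proof (induction i)
    case 0
    have "\<psi> \<one>\<^bsub>G\<^esub> \<otimes>\<^bsub>K\<^esub> \<psi> \<one>\<^bsub>G\<^esub> = \<psi> \<one>\<^bsub>G\<^esub>"
      using \<psi>_mult[of "\<one>\<^bsub>G\<^esub>" "\<one>\<^bsub>G\<^esub>"] by simp
    then show ?case
      using \<psi>_N[of "\<one>\<^bsub>G\<^esub>"] by simp
  next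
    case (Suc i)
    then show ?case
      using g by (simp add: \<psi>_mult)
  qed
  have "\<exists>z \<in> carrier K. \<pi> z = x \<and> z [^]\<^bsub>K\<^esub> group.ord H x = \<one>\<^bsub>K\<^esub>" if x: "x \<in> carrier H" for x
  proof -
    obtain y where y: "y \<in> carrier K" "\<pi> y = x"
      using x unfolding surj[symmetric] by auto
    have "coprime (card N) (group.ord H x)"
      unfolding cardN
      by (rule coprime_divisors[OF dvd_refl \<pi>.H.ord_dvd_group_order[OF x] coprime])
    then show ?thesis
      using \<pi>.exists_lift_of_same_exponent[of "group.ord H x" y] finN x y
      by (simp add: N_def)
  qed
  then obtain s where s: "\<And>x. x \<in> carrier H \<Longrightarrow> s x \<in> carrier K"
    and \<pi>_s: "\<And>x. x \<in> carrier H \<Longrightarrow> \<pi> (s x) = x"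
    and s_pow: "\<And>x. x \<in> carrier H \<Longrightarrow> s x [^]\<^bsub>K\<^esub> group.ord H x = \<one>\<^bsub>K\<^esub>"
    by metis
  define f where "f = (\<lambda>(g, x). \<psi> g \<otimes>\<^bsub>K\<^esub> s x)"
  have \<pi>_f: "\<pi> (f (g, x)) = x" if "g \<in> carrier G" "x \<in> carrier H" for g x
  proof -
    have "\<pi> (\<psi> g) = \<one>\<^bsub>H\<^esub>"
      using \<psi>_N[OF that(1)] unfolding N_def kernel_def by simp
    then show ?thesis
      using \<psi>_K[OF that(1)] s[OF that(2)] \<pi>_s[OF that(2)] that(2) by (simp add: f_def)
  qed
  have "bij_betw f (carrier (G \<times>\<times> H)) (carrier K)"
  proof (rule bij_betw_imageI)
    show "inj_on f (carrier (G \<times>\<times> H))"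
    proof (rule inj_onI, clarsimp)
      fix g x g' x'
      assume in_carrier: "g \<in> carrier G" "x \<in> carrier H" "g' \<in> carrier G" "x' \<in> carrier H"
        and eq: "f (g, x) = f (g', x')"
      then have x: "x = x'"
        using \<pi>_f by metis
      then have "\<psi> g = \<psi> g'"
        using eq in_carrier s \<psi>_K by (auto simp: f_def)
      then show "g = g' \<and> x = x'"
        using x in_carrier inj_onD[OF \<psi>_inj] by simp
    qed
    show "f ` carrier (G \<times>\<times> H) = carrier K"
    proof
      show "f ` carrier (G \<times>\<times> H) \<subseteq> carrier K"
        using \<psi>_K s by (auto simp: f_def)
      show "carrier K \<subseteq> f ` carrier (G \<times>\<times> H)"
      proof
        fix k assume k: "k \<in> carrier K"
        have x: "\<pi> k \<in> carrier H"
          using k by simp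
        have "k \<otimes>\<^bsub>K\<^esub> inv\<^bsub>K\<^esub> s (\<pi> k) \<in> N"
        proof -
          have "\<pi> (k \<otimes>\<^bsub>K\<^esub> inv\<^bsub>K\<^esub> s (\<pi> k)) = \<pi> k \<otimes>\<^bsub>H\<^esub> inv\<^bsub>H\<^esub> \<pi> (s (\<pi> k))"
            by (simp only: \<pi>.hom_mult[OF k \<pi>.G.inv_closed[OF s[OF x]]] \<pi>.hom_inv[OF s[OF x]])
          also have "\<dots> = \<one>\<^bsub>H\<^esub>"
            unfolding \<pi>_s[OF x] by (rule \<pi>.H.r_inv[OF x])
          finally show ?thesis
            unfolding N_def kernel_def using \<pi>.G.m_closed[OF k \<pi>.G.inv_closed[OF s[OF x]]] by blast
        qed
        then obtain g where g: "g \<in> carrier G" "\<psi> g = k \<otimes>\<^bsub>K\<^esub> inv\<^bsub>K\<^esub> s (\<pi> k)"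
          unfolding \<psi>_image by (metis imageE)
        then have "f (g, \<pi> k) = k"
          using \<pi>.G.inv_solve_right[OF \<psi>_K[OF g(1)] k s[OF x]] by (simp add: f_def)
        moreover have "(g, \<pi> k) \<in> carrier (G \<times>\<times> H)"
          using g(1) x by simp
        ultimately show "k \<in> f ` carrier (G \<times>\<times> H)"
          by (metis imageI)
      qed
    qed
  qed
  moreover have "group.ord K (f (g, x)) dvd group.ord (G \<times>\<times> H) (g, x)"
    if g: "g \<in> carrier G" and x: "x \<in> carrier H" for g x
  proof -
    have "\<psi> g [^]\<^bsub>K\<^esub> group.ord G g = \<one>\<^bsub>K\<^esub>"
      using \<psi>_pow[OF g, of "group.ord G g"] \<psi>_pow[OF g, of 0] g by simp
    then have "f (g, x) [^]\<^bsub>K\<^esub> (group.ord H x * group.ord G g) = \<one>\<^bsub>K\<^esub>"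
      unfolding f_def using N.pow_mult_of_normal_abelian[OF comm \<psi>_N[OF g] s[OF x] s_pow[OF x]]
      by simp
    then have "group.ord K (f (g, x)) dvd group.ord G g * group.ord H x"
      using \<psi>_K[OF g] s[OF x] by (subst \<pi>.G.pow_eq_id[symmetric]) (auto simp: f_def mult.commute)
    then show ?thesis
      using ord_DirProd_coprime[OF G.group_axioms H g x coprime_ord[OF G.group_axioms H coprime g x]]
      by simp
  qed
  ultimately show ?thesis
    unfolding strongly_dominates_def by (intro exI[of _ f]) auto
qed

theorem theorem2p6:
  fixes G :: "('a, 'm) monoid_scheme"
    and H :: "('b, 'n) monoid_scheme"
    and K :: "('k, 'l) monoid_scheme"
  assumes "comm_group G" and "finite (carrier G)"
    and "group H" and "finite (carrier H)"
    and "coprime (order G) (order H)"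
    and "is_extension K G H"
  shows "order_sequence (G \<times>\<times> H) = seq_product (order_sequence G) (order_sequence H)
       \<and> strongly_dominates (G \<times>\<times> H) K"
  using order_sequence_DirProd[OF comm_group.axioms(2)[OF assms(1)] assms(2-5)]
    extension_strongly_dominated[OF assms] by blast

end
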